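(* Let $n\ge 1$, let $\Delta\subset\mathbb{R}^n$ be an $n$-simplex with vertices $\mathbf{x}_0,\dots,\mathbf{x}_n$, and let $f\colon\Delta\to\mathbb{R}$ be convex. For a partition $\mathcal{K}=\{K_1,\dots,K_p\}$ of $N=\{0,1,\dots,n\}$ define $$F(\mathcal{K})=\sum_{i=1}^p \operatorname{card}(K_i)\,\operatorname{Avg}(f,\Delta_{K_i}).$$ If $\mathcal{K}$ and $\mathcal{L}$ are partitions of $N$ with $\mathcal{L}\prec\mathcal{K}$, then $F(\mathcal{K})\le F(\mathcal{L})$.
   Context: $\mathbf{x}_0,\dots,\mathbf{x}_n\in\mathbb{R}^n$ are affinely independent (the vectors $\mathbf{x}_i-\mathbf{x}_0$, $i=1,\dots,n$, are linearly independent) and $\Delta=\operatorname{conv}\{\mathbf{x}_0,\dots,\mathbf{x}_n\}$. For nonempty $K\subset N$ with $\operatorname{card}K=k+1$, $\Delta_K=\operatorname{conv}\{\mathbf{x}_i: i\in K\}$ is a $k$-simplex (a face of $\Delta$). For a $k$-simplex $\Sigma$ and integrable $g\colon\Sigma\to\mathbb{R}$, $\operatorname{Avg}(g,\Sigma)=\frac{1}{\operatorname{Vol}_k(\Sigma)}\int_\Sigma g\,d\mathbf{x}$, where integration is with respect to $k$-dimensional Lebesgue measure on the affine hull of $\Sigma$ and $\operatorname{Vol}_k$ is $k$-dimensional volume; for a $0$-simplex $\{\mathbf{y}\}$, $\operatorname{Avg}(g,\{\mathbf{y}\})=g(\mathbf{y})$. A partition of $N$ is a family of pairwise disjoint nonempty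 subsets of $N$ whose union is $N$. For partitions $\mathcal{K},\mathcal{L}$ of $N$, $\mathcal{L}\prec\mathcal{K}$ ($\mathcal{L}$ refines $\mathcal{K}$) means every element of $\mathcal{L}$ is a subset of some element of $\mathcal{K}$. *)

theory Defs
  imports "HOL-Analysis.Analysis"
begin

definition std_simplex :: "nat \<Rightarrow> (nat \<Rightarrow> real) set" where
  "std_simplex k = {t \<in> PiE {..<k} (\<lambda>_. UNIV). (\<forall>j<k. 0 \<le> t j) \<and> (\<Sum>j<k. t j) \<le> 1}"

definition param_measure :: "nat \<Rightarrow> (nat \<Rightarrow> real) measure" where
  "param_measure k = PiM {..<k} (\<lambda>_. lborel)"

definition simplex_param :: "'a::real_vector list \<Rightarrow> (nat \<Rightarrow> real) \<Rightarrow> 'a" where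
  "simplex_param ys t = ys!0 + (\<Sum>j<length ys - 1. t j *\<^sub>R (ys!(Suc j) - ys!0))"

text \<open>Average of g over the k-simplex conv(set ys), k = length ys - 1.
  Since the affine parametrisation has constant k-dimensional Jacobian, this equals
  (1/Vol_k) times the integral w.r.t. k-dimensional Lebesgue measure on the affine hull.
  For k = 0 it gives g (ys!0).\<close>
definition simplex_avg :: "('a::real_vector \<Rightarrow> real) \<Rightarrow> 'a list \<Rightarrow> real" where
  "simplex_avg g ys =
     (LINT t : std_simplex (length ys - 1) | param_measure (length ys - 1). g (simplex_param ys t))
     / measure (param_measure (length ys - 1)) (std_simplex (length ys - 1))"

definition face_avg :: "('a::real_vector \<Rightarrow> real) \<Rightarrow> (nat \<Rightarrow> 'a) \<Rightarrow> nat set \<Rightarrow> real" where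
  "face_avg g x K = simplex_avg g (map x (sorted_list_of_set K))"

definition is_partition :: "'b set \<Rightarrow> 'b set set \<Rightarrow> bool" where
  "is_partition N P \<longleftrightarrow> (\<forall>K\<in>P. K \<noteq> {}) \<and> pairwise disjnt P \<and> \<Union>P = N"

definition refines :: "'b set set \<Rightarrow> 'b set set \<Rightarrow> bool" where
  "refines L K \<longleftrightarrow> (\<forall>A\<in>L. \<exists>B\<in>K. A \<subseteq> B)"

definition F_part :: "('a::real_vector \<Rightarrow> real) \<Rightarrow> (nat \<Rightarrow> 'a) \<Rightarrow> nat set set \<Rightarrow> real" where
  "F_part f x P = (\<Sum>K\<in>P. real (card K) * face_avg f x K)"

end

theory Submission
  imports Defs "HOL-Probability.Probability"
begin

text \<open>Let \<open>e\<^sub>i\<close> be independent standard exponential variables and put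
  \<open>S\<^sub>A = \<Sum>i\<in>A. e\<^sub>i\<close>. The point \<open>(\<Sum>i\<in>A. e\<^sub>i x\<^sub>i) / S\<^sub>A\<close> is uniformly
  distributed on the face of \<open>A\<close> and independent of \<open>S\<^sub>A\<close>, whose mean is \<open>card A\<close>; hence
  \<open>card A * Avg f A\<close> is the expectation of \<open>\<phi> A = S\<^sub>A f ((\<Sum>i\<in>A. e\<^sub>i x\<^sub>i) / S\<^sub>A)\<close>.
  Convexity of \<open>f\<close> makes this perspective function subadditive over disjoint unions
  pointwise, and taking expectations gives the claim.\<close>

section \<open>Densities and scaling for product Lebesgue measure\<close>

text \<open>Product measures are determined by boxes, and over a box the integral of a product
  density splits into one-dimensional integrals. It serves twice: a constant \<open>d\<close> gives
  the scaling law, the exponential density gives the joint law of independent exponentials.\<close>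

lemma PiM_density_lborel:
  fixes d :: "real \<Rightarrow> ennreal"
  assumes "finite I" and [measurable]: "d \<in> borel_measurable borel"
    and "sigma_finite_measure (density lborel d)"
  shows "PiM I (\<lambda>_. density lborel d) = density (PiM I (\<lambda>_. lborel)) (\<lambda>x. \<Prod>i\<in>I. d (x i))"
proof -
  interpret D: product_sigma_finite "\<lambda>_. density lborel d"
    using assms(3) by (simp add: product_sigma_finite_def)
  interpret L: product_sigma_finite "\<lambda>_::'a. lborel :: real measure"
    by (simp add: product_sigma_finite_def sigma_finite_lborel)
  have "density (PiM I (\<lambda>_. lborel)) (\<lambda>x. \<Prod>i\<in>I. d (x i)) = PiM I (\<lambda>_. density lborel d)"
  proof (rule D.PiM_eqI[OF assms(1)])
    show "sets (density (PiM I (\<lambda>_. lborel)) (\<lambda>x. \<Prod>i\<in>I. d (x i))) = sets (PiM I (\<lambda>_. density lborel d))"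
      by (simp cong: sets_PiM_cong)
    fix A assume A: "\<And>i. i \<in> I \<Longrightarrow> A i \<in> sets (density lborel d)"
    have [measurable]: "Pi\<^sub>E I A \<in> sets (PiM I (\<lambda>_. lborel))"
      using A assms(1) by (intro sets_PiM_I_finite) auto
    have "emeasure (density (PiM I (\<lambda>_. lborel)) (\<lambda>x. \<Prod>i\<in>I. d (x i))) (Pi\<^sub>E I A)
        = (\<integral>\<^sup>+x. (\<Prod>i\<in>I. d (x i)) * indicator (Pi\<^sub>E I A) x \<partial>PiM I (\<lambda>_. lborel))"
      using assms(1) by (subst emeasure_density) auto
    also have "\<dots> = (\<integral>\<^sup>+x. (\<Prod>i\<in>I. d (x i) * indicator (A i) (x i)) \<partial>PiM I (\<lambda>_. lborel))"
    proof (intro nn_integral_cong)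
      \<comment> \<open>Membership in \<open>Pi\<^sub>E I A\<close> also demands extensionality,
        which points of the product space have; for them the indicator factorises.\<close>
      fix x assume "x \<in> space (PiM I (\<lambda>_. lborel :: real measure))"
      then have "x \<in> extensional I" by (auto simp: space_PiM PiE_def)
      then have "indicator (Pi\<^sub>E I A) x = (\<Prod>i\<in>I. indicator (A i) (x i) :: ennreal)"
        using assms(1) by (auto simp: indicator_def PiE_def Pi_def prod_zero_iff)
      then show "(\<Prod>i\<in>I. d (x i)) * indicator (Pi\<^sub>E I A) x = (\<Prod>i\<in>I. d (x i) * indicator (A i) (x i))"
        by (simp add: prod.distrib)
    qed
    also have "\<dots> = (\<Prod>i\<in>I. \<integral>\<^sup>+x. d x * indicator (A i) x \<partial>lborel)"
      using A by (intro L.product_nn_integral_prod assms(1)) auto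
    also have "\<dots> = (\<Prod>i\<in>I. emeasure (density lborel d) (A i))"
      using A by (intro prod.cong) (auto simp: emeasure_density)
    finally show "emeasure (density (PiM I (\<lambda>_. lborel)) (\<lambda>x. \<Prod>i\<in>I. d (x i))) (Pi\<^sub>E I A)
        = (\<Prod>i\<in>I. emeasure (density lborel d) (A i))" .
  qed
  then show ?thesis ..
qed

text \<open>Dividing one coordinate by \<open>s\<close> turns Lebesgue measure into \<open>s\<close>
  times itself, so the pushforward on \<open>I\<close> has constant density
  \<open>s ^ card I\<close>. This is the Jacobian in the later passage to normalised
  coordinates.\<close>

lemma nn_integral_PiM_lborel_scale:
  fixes s :: real
  assumes "finite I" "s > 0" and [measurable]: "g \<in> borel_measurable (PiM I (\<lambda>_. lborel))"
  shows "(\<integral>\<^sup>+x. g (\<lambda>j\<in>I. x j / s) \<partial>PiM I (\<lambda>_. lborel))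
       = ennreal (s ^ card I) * (\<integral>\<^sup>+x. g x \<partial>PiM I (\<lambda>_. lborel))"
proof -
  let ?L = "PiM I (\<lambda>_. lborel :: real measure)"
  let ?d = "\<lambda>_::real. ennreal s"
  have sf: "sigma_finite_measure (density lborel ?d)"
    using sigma_finite_measure.sigma_finite_iff_density_finite'[OF sigma_finite_lborel, of ?d] by auto
  interpret D: product_sigma_finite "\<lambda>_. density lborel ?d"
    using sf by (simp add: product_sigma_finite_def)
  interpret L: product_sigma_finite "\<lambda>_::'a. lborel :: real measure"
    by (simp add: product_sigma_finite_def sigma_finite_lborel)
  have T[measurable]: "(\<lambda>x. \<lambda>j\<in>I. x j / s) \<in> measurable ?L ?L"
    by measurable
  have "distr ?L ?L (\<lambda>x. \<lambda>j\<in>I. x j / s) = PiM I (\<lambda>_. density lborel ?d)"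
  proof (rule D.PiM_eqI[OF assms(1)])
    show "sets (distr ?L ?L (\<lambda>x. \<lambda>j\<in>I. x j / s)) = sets (PiM I (\<lambda>_. density lborel ?d))"
      by (simp cong: sets_PiM_cong)
    fix A assume A: "\<And>i. i \<in> I \<Longrightarrow> A i \<in> sets (density lborel ?d)"
    have [measurable]: "A i \<in> sets borel" if "i \<in> I" for i
      using A[OF that] by simp
    have "emeasure (distr ?L ?L (\<lambda>x. \<lambda>j\<in>I. x j / s)) (Pi\<^sub>E I A)
        = emeasure ?L ((\<lambda>x. \<lambda>j\<in>I. x j / s) -` Pi\<^sub>E I A \<inter> space ?L)"
      using A assms(1) by (intro emeasure_distr sets_PiM_I_finite) auto
    also have "(\<lambda>x. \<lambda>j\<in>I. x j / s) -` Pi\<^sub>E I A \<inter> space ?L = Pi\<^sub>E I (\<lambda>i. {x. x / s \<in> A i})"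
      by (auto simp: space_PiM PiE_def Pi_def)
    also have "emeasure ?L \<dots> = (\<Prod>i\<in>I. emeasure lborel {x. x / s \<in> A i})"
      by (intro L.emeasure_PiM assms(1)) measurable
    also have "\<dots> = (\<Prod>i\<in>I. emeasure (density lborel ?d) (A i))"
    proof (intro prod.cong refl)
      fix i assume i[measurable]: "i \<in> I"
      have "{x. x / s \<in> A i} \<in> sets lborel"
        using measurable_sets[of "\<lambda>x. x / s" borel borel "A i"] i by (simp add: vimage_def)
      then have "emeasure lborel {x. x / s \<in> A i} = (\<integral>\<^sup>+x. indicator {x. x / s \<in> A i} x \<partial>lborel)"
        by (rule nn_integral_indicator[symmetric])
      also have "\<dots> = (\<integral>\<^sup>+x. indicator (A i) (x / s) \<partial>lborel)"
        by (simp add: indicator_def)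
      also have "\<dots> = ennreal s * (\<integral>\<^sup>+x. indicator (A i) x \<partial>lborel)"
        using assms(2) by (subst nn_integral_real_affine[of _ s 0]) auto
      finally show "emeasure lborel {x. x / s \<in> A i} = emeasure (density lborel ?d) (A i)"
        by (simp add: emeasure_density_const)
    qed
    finally show "emeasure (distr ?L ?L (\<lambda>x. \<lambda>j\<in>I. x j / s)) (Pi\<^sub>E I A)
        = (\<Prod>i\<in>I. emeasure (density lborel ?d) (A i))" .
  qed
  also have "\<dots> = density ?L (\<lambda>_. ennreal (s ^ card I))"
    using sf assms by (subst PiM_density_lborel) (auto simp: ennreal_power)
  finally have eq: "distr ?L ?L (\<lambda>x. \<lambda>j\<in>I. x j / s) = density ?L (\<lambda>_. ennreal (s ^ card I))" .
  have "(\<integral>\<^sup>+x. g (\<lambda>j\<in>I. x j / s) \<partial>?L) = (\<integral>\<^sup>+x. g x \<partial>distr ?L ?L (\<lambda>x. \<lambda>j\<in>I. x j / s))"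
    by (simp add: nn_integral_distr)
  also have "\<dots> = ennreal (s ^ card I) * (\<integral>\<^sup>+x. g x \<partial>?L)"
    unfolding eq by (simp add: nn_integral_density nn_integral_cmult)
  finally show ?thesis .
qed

section \<open>Independent standard exponential variables\<close>

abbreviation expo :: "real measure" where
  "expo \<equiv> density lborel (exponential_density 1)"

lemma prob_space_expo: "prob_space expo"
  by (simp add: prob_space_exponential_density)

lemma expo_mean: "integrable expo (\<lambda>x. x)" "(\<integral>x. x \<partial>expo) = 1"
proof -
  have nn: "AE x in expo. 0 \<le> x"
    by (subst AE_density) (auto simp: exponential_density_def)
  \<comment> \<open>The exponential density is the Erlang density of shape 0, so the mean is its
    first moment; \<open>ennreal\<close> cuts off negative \<open>x\<close>, where the density
    vanishes anyway.\<close>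
  have "(\<integral>\<^sup>+x. ennreal x \<partial>expo) = (\<integral>\<^sup>+x. ennreal (erlang_density 0 1 x * x ^ 1) \<partial>lborel)"
    by (subst nn_integral_density)
      (auto intro!: nn_integral_cong simp: ennreal_mult' exponential_density_def)
  also have "\<dots> = ennreal 1"
    by (subst nn_integral_erlang_ith_moment) auto
  finally have e: "(\<integral>\<^sup>+x. ennreal x \<partial>expo) = ennreal 1" .
  show "integrable expo (\<lambda>x. x)"
    using nn e by (intro integrableI_nonneg) auto
  show "(\<integral>x. x \<partial>expo) = 1"
    using nn e by (subst integral_eq_nn_integral) auto
qed

lemma PiM_expo_component:
  fixes I :: "'i set"
  assumes "i \<in> I"
  shows "integrable (PiM I (\<lambda>_. expo)) (\<lambda>e. e i)" "(\<integral>e. e i \<partial>PiM I (\<lambda>_. expo)) = 1"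
    and "AE e in PiM I (\<lambda>_. expo). 0 \<le> e i"
proof -
  have d: "distr (PiM I (\<lambda>_. expo)) expo (\<lambda>e. e i) = expo"
    using distr_PiM_component[of I "\<lambda>_. expo", OF prob_space_expo assms] .
  have [measurable]: "(\<lambda>e. e i) \<in> measurable (PiM I (\<lambda>_. expo)) expo"
    using assms by (rule measurable_component_singleton)
  show "integrable (PiM I (\<lambda>_. expo)) (\<lambda>e. e i)"
    using expo_mean(1) integrable_distr[of "\<lambda>e. e i" "PiM I (\<lambda>_. expo)" expo "\<lambda>x. x"] d by simp
  show "(\<integral>e. e i \<partial>PiM I (\<lambda>_. expo)) = 1"
    using expo_mean(2) integral_distr[of "\<lambda>e. e i" "PiM I (\<lambda>_. expo)" expo "\<lambda>x. x"] d by simp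
  have "AE x in expo. 0 \<le> x"
    by (subst AE_density) (auto simp: exponential_density_def)
  then show "AE e in PiM I (\<lambda>_. expo). 0 \<le> e i"
    using assms by (intro AE_PiM_component prob_space_expo)
qed

section \<open>Normalised exponentials and the uniform law on the simplex\<close>

text \<open>The last barycentric coordinate is dropped, being one minus the others; what remains is
  a point of the parameter space of \<open>std_simplex k\<close>, extensional as points of
  \<open>PiM\<close> must be. A zero total gives zeros, because division by zero is zero.\<close>

definition normalize_coords :: "nat \<Rightarrow> (nat \<Rightarrow> real) \<Rightarrow> nat \<Rightarrow> real" where
  "normalize_coords k e = (\<lambda>j\<in>{..<k}. e j / (\<Sum>i<Suc k. e i))"

lemma sets_PiM_expo [measurable_cong]: "sets (PiM I (\<lambda>_. expo)) = sets (PiM I (\<lambda>_. lborel))"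
  by (intro sets_PiM_cong) auto

lemma measurable_normalize_coords [measurable]:
  "normalize_coords k \<in> measurable (PiM {..<Suc k} (\<lambda>_. expo)) (PiM {..<k} (\<lambda>_. lborel))"
  unfolding normalize_coords_def by measurable

lemma std_simplex_measurable [measurable]: "std_simplex k \<in> sets (PiM {..<k} (\<lambda>_. lborel))"
proof -
  have "std_simplex k = {t \<in> space (PiM {..<k} (\<lambda>_. lborel)). (\<forall>j\<in>{..<k}. 0 \<le> t j) \<and> (\<Sum>j<k. t j) \<le> 1}"
    by (auto simp: std_simplex_def space_PiM)
  also have "\<dots> \<in> sets (PiM {..<k} (\<lambda>_. lborel))"
    by measurable
  finally show ?thesis .
qed

text \<open>Change of variables from \<open>k + 1\<close> coordinates to their total
  \<open>s\<close> and \<open>k\<close> ratios. The joint density depends on \<open>s\<close> alone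
  and scaling contributes \<open>s ^ k\<close>, so the integral factorises: this is the independence
  of total and direction. The weight by the total is the factor \<open>s\<close> in front of
  \<open>exp (- s)\<close>.\<close>

lemma nn_integral_normalize_coords:
  assumes [measurable]: "g \<in> borel_measurable (PiM {..<k} (\<lambda>_. lborel))"
  shows "(\<integral>\<^sup>+e. ennreal (\<Sum>i<Suc k. e i) * g (normalize_coords k e) \<partial>PiM {..<Suc k} (\<lambda>_. expo))
    = (\<integral>\<^sup>+s. ennreal (s * exp (- s)) * ennreal (s ^ k) \<partial>lborel)
      * (\<integral>\<^sup>+t. indicator (std_simplex k) t * g t \<partial>PiM {..<k} (\<lambda>_. lborel))"
proof -
  let ?L = "\<lambda>k. PiM {..<k} (\<lambda>_. lborel :: real measure)"
  let ?S = "\<lambda>e. \<Sum>i<Suc k. e i :: real"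
  let ?H = "\<lambda>t. indicator (std_simplex k) t * g t"
  \<comment> \<open>\<open>F e s\<close> is the integrand with the last coordinate expressed as
    \<open>s\<close> minus the sum of the others; nonnegativity of that coordinate becomes the upper
    bound \<open>s\<close> on the sum.\<close>
  define F where "F = (\<lambda>e s. if (\<forall>i\<in>{..<k}. 0 \<le> e i) \<and> (\<Sum>i<k. e i) \<le> s
    then ennreal (s * exp (- s)) * g (\<lambda>j\<in>{..<k}. e j / s) else 0)"
  interpret L: product_sigma_finite "\<lambda>_::nat. lborel :: real measure"
    by (simp add: product_sigma_finite_def sigma_finite_lborel)
  interpret Lk: sigma_finite_measure "?L k"
    by (intro L.sigma_finite) auto
  interpret LL: pair_sigma_finite lborel "?L k" ..
  have F_meas[measurable]: "(\<lambda>(s, e). F e s) \<in> borel_measurable (lborel \<Otimes>\<^sub>M ?L k)"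
  proof -
    have [measurable]: "(\<lambda>p. g (\<lambda>j\<in>{..<k}. snd p j / fst p)) \<in> borel_measurable (lborel \<Otimes>\<^sub>M ?L k)"
      by measurable
    have [measurable]: "(\<lambda>p. snd p i) \<in> borel_measurable (lborel \<Otimes>\<^sub>M ?L k)" if "i \<in> {..<k}" for i
      using that by measurable
    have [measurable]: "Measurable.pred (lborel \<Otimes>\<^sub>M ?L k) (\<lambda>p. (\<forall>i\<in>{..<k}. 0 \<le> snd p i))"
      by (intro pred_intros_finite) auto
    have [measurable]: "Measurable.pred (lborel \<Otimes>\<^sub>M ?L k) (\<lambda>p. (\<Sum>i<k. snd p i) \<le> fst p)"
      by measurable
    have "Measurable.pred (lborel \<Otimes>\<^sub>M ?L k) (\<lambda>p. (\<forall>i\<in>{..<k}. 0 \<le> snd p i) \<and> (\<Sum>i<k. snd p i) \<le> fst p)"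
      by measurable
    moreover have "(\<lambda>p. ennreal (fst p * exp (- fst p)) * g (\<lambda>j\<in>{..<k}. snd p j / fst p)) \<in> borel_measurable (lborel \<Otimes>\<^sub>M ?L k)"
      by measurable
    ultimately show ?thesis
      unfolding F_def split_beta' by (intro measurable_If borel_measurable_const predE)
  qed
  have dens: "(\<Prod>i\<in>{..<Suc k}. ennreal (exponential_density 1 (e i))) =
      (if \<forall>i\<in>{..<Suc k}. 0 \<le> e i then ennreal (exp (- ?S e)) else 0)" for e
  proof (cases "\<forall>i\<in>{..<Suc k}. 0 \<le> e i")
    case True
    have "(\<Prod>i\<in>{..<Suc k}. ennreal (exponential_density 1 (e i))) = (\<Prod>i\<in>{..<Suc k}. ennreal (exp (- e i)))"
      using True by (intro prod.cong) (force simp: exponential_density_def not_less[symmetric])+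
    also have "\<dots> = ennreal (\<Prod>i\<in>{..<Suc k}. exp (- e i))"
      by (rule prod_ennreal) auto
    also have "(\<Prod>i\<in>{..<Suc k}. exp (- e i)) = exp (- ?S e)"
      unfolding sum_negf[symmetric] by (rule exp_sum[symmetric]) auto
    finally show ?thesis using True by simp
  next
    case False
    then obtain i where "i \<in> {..<Suc k}" "e i < 0"
      by (meson not_le)
    then have "(\<Prod>i\<in>{..<Suc k}. ennreal (exponential_density 1 (e i))) = 0"
      by (intro prod_zero bexI[of _ i]) (auto simp: exponential_density_def)
    then show ?thesis unfolding if_not_P[OF False] .
  qed
  have "(\<integral>\<^sup>+e. ennreal (?S e) * g (normalize_coords k e) \<partial>PiM {..<Suc k} (\<lambda>_. expo))
      = (\<integral>\<^sup>+e. (\<Prod>i\<in>{..<Suc k}. ennreal (exponential_density 1 (e i))) * (ennreal (?S e) * g (normalize_coords k e)) \<partial>?L (Suc k))"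
    using prob_space_expo
    by (subst PiM_density_lborel)
      (auto intro!: nn_integral_density prob_space_imp_sigma_finite simp: normalize_coords_def simp del: sum.lessThan_Suc prod.lessThan_Suc)
  also have "\<dots> = (\<integral>\<^sup>+e. (\<lambda>e. if \<forall>i\<in>{..<Suc k}. 0 \<le> e i then ennreal (?S e * exp (- ?S e)) * g (\<lambda>j\<in>{..<k}. e j / ?S e) else 0) e
      \<partial>PiM (insert k {..<k}) (\<lambda>_. lborel))"
    unfolding dens lessThan_Suc[symmetric]
    by (intro nn_integral_cong)
      (auto simp: normalize_coords_def ennreal_mult'' mult_ac sum_nonneg simp del: sum.lessThan_Suc)
  also have "\<dots> = (\<integral>\<^sup>+e. \<integral>\<^sup>+u. (\<lambda>e. if \<forall>i\<in>{..<Suc k}. 0 \<le> e i then ennreal (?S e * exp (- ?S e)) * g (\<lambda>j\<in>{..<k}. e j / ?S e) else 0) (e(k := u))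
      \<partial>lborel \<partial>?L k)"
    by (rule L.product_nn_integral_insert) (auto simp flip: lessThan_Suc simp del: sum.lessThan_Suc)
  also have "\<dots> = (\<integral>\<^sup>+e. \<integral>\<^sup>+s. F e s \<partial>lborel \<partial>?L k)"
  proof (rule nn_integral_cong)
    \<comment> \<open>For fixed first coordinates, the last coordinate and the total differ by a
      translation, which preserves Lebesgue measure.\<close>
    fix e assume [measurable]: "e \<in> space (?L k)"
    have [measurable]: "F e \<in> borel_measurable borel"
      using measurable_compose[OF measurable_Pair2'[of e "?L k" lborel] F_meas] \<open>e \<in> space (?L k)\<close> by simp
    have "(\<integral>\<^sup>+s. F e s \<partial>lborel) = (\<integral>\<^sup>+u. F e ((\<Sum>i<k. e i) + u) \<partial>lborel)"
      using nn_integral_real_affine[of "F e" 1 "\<Sum>i<k. e i"] by simp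
    also have "\<dots> = (\<integral>\<^sup>+u. (\<lambda>e. if \<forall>i\<in>{..<Suc k}. 0 \<le> e i then ennreal (?S e * exp (- ?S e)) * g (\<lambda>j\<in>{..<k}. e j / ?S e) else 0) (e(k := u)) \<partial>lborel)"
    proof (intro nn_integral_cong)
      fix u :: real
      have S: "?S (e(k := u)) = (\<Sum>i<k. e i) + u" by simp
      have R: "(\<lambda>j\<in>{..<k}. (e(k := u)) j / s) = (\<lambda>j\<in>{..<k}. e j / s)" for s
        by auto
      have C: "(\<forall>i\<in>{..<Suc k}. 0 \<le> (e(k := u)) i) \<longleftrightarrow> (\<forall>i\<in>{..<k}. 0 \<le> e i) \<and> 0 \<le> u"
        by (auto simp: less_Suc_eq)
      show "F e ((\<Sum>i<k. e i) + u) = (\<lambda>e. if \<forall>i\<in>{..<Suc k}. 0 \<le> e i then ennreal (?S e * exp (- ?S e)) * g (\<lambda>j\<in>{..<k}. e j / ?S e) else 0) (e(k := u))"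
        unfolding S R C F_def by auto
    qed
    finally show "(\<integral>\<^sup>+u. (\<lambda>e. if \<forall>i\<in>{..<Suc k}. 0 \<le> e i then ennreal (?S e * exp (- ?S e)) * g (\<lambda>j\<in>{..<k}. e j / ?S e) else 0) (e(k := u)) \<partial>lborel)
        = (\<integral>\<^sup>+s. F e s \<partial>lborel)" ..
  qed
  also have "\<dots> = (\<integral>\<^sup>+s. \<integral>\<^sup>+e. F e s \<partial>?L k \<partial>lborel)"
    by (rule LL.Fubini') measurable
  also have "\<dots> = (\<integral>\<^sup>+s. ennreal (s * exp (- s)) * ennreal (s ^ k) * (\<integral>\<^sup>+t. ?H t \<partial>?L k) \<partial>lborel)"
  proof (intro nn_integral_cong)
    fix s :: real
    show "(\<integral>\<^sup>+e. F e s \<partial>?L k) = ennreal (s * exp (- s)) * ennreal (s ^ k) * (\<integral>\<^sup>+t. ?H t \<partial>?L k)"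
    proof (cases "s > 0")
      \<comment> \<open>Where \<open>s\<close> is not positive, \<open>ennreal\<close> truncates
        \<open>s * exp (- s)\<close> to zero, so both sides vanish.\<close>
      case False
      then have "s * exp (- s) \<le> 0" by (simp add: mult_le_0_iff)
      then have "ennreal (s * exp (- s)) = 0" by (rule ennreal_neg)
      moreover from this have "F e s = 0" for e by (simp add: F_def)
      ultimately show ?thesis by simp
    next
      case True
      have "F e s = ennreal (s * exp (- s)) * ?H (\<lambda>j\<in>{..<k}. e j / s)" for e
      proof -
        \<comment> \<open>For positive \<open>s\<close> the constraints in \<open>F\<close> say
          exactly that the ratios lie in \<open>std_simplex k\<close>.\<close>
        have "(\<Sum>j<k. e j / s) \<le> 1 \<longleftrightarrow> (\<Sum>j<k. e j) \<le> s"
          using True by (simp add: sum_divide_distrib[symmetric] divide_le_eq)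
        then have "(\<lambda>j\<in>{..<k}. e j / s) \<in> std_simplex k \<longleftrightarrow> (\<forall>i\<in>{..<k}. 0 \<le> e i) \<and> (\<Sum>i<k. e i) \<le> s"
          using True by (auto simp: std_simplex_def zero_le_divide_iff)
        then show ?thesis by (simp add: F_def)
      qed
      then have "(\<integral>\<^sup>+e. F e s \<partial>?L k) = ennreal (s * exp (- s)) * (\<integral>\<^sup>+e. ?H (\<lambda>j\<in>{..<k}. e j / s) \<partial>?L k)"
        by (simp add: nn_integral_cmult)
      also have "(\<integral>\<^sup>+e. ?H (\<lambda>j\<in>{..<k}. e j / s) \<partial>?L k) = ennreal (s ^ k) * (\<integral>\<^sup>+t. ?H t \<partial>?L k)"
        using True by (subst nn_integral_PiM_lborel_scale[where g="?H"]) auto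
      finally show ?thesis by (simp add: mult_ac)
    qed
  qed
  also have "\<dots> = (\<integral>\<^sup>+s. ennreal (s * exp (- s)) * ennreal (s ^ k) \<partial>lborel) * (\<integral>\<^sup>+t. ?H t \<partial>?L k)"
    by (intro nn_integral_multc) measurable
  finally show ?thesis .
qed

text \<open>The total-weighted law of the normalised vector is a constant multiple of Lebesgue
  measure on the simplex, by the preceding formula for indicators. The constant function 1 gives the
  mean total \<open>k + 1\<close>, which fixes the constant relative to the volume; neither the
  Gamma integral \<open>C\<close> nor the volume of \<open>std_simplex k\<close> is
  evaluated.\<close>

lemma integral_normalize_coords:
  fixes G :: "(nat \<Rightarrow> real) \<Rightarrow> real"
  assumes [measurable]: "G \<in> borel_measurable (PiM {..<k} (\<lambda>_. lborel))"
  shows "(\<integral>e. (\<Sum>i<Suc k. e i) * G (normalize_coords k e) \<partial>PiM {..<Suc k} (\<lambda>_. expo))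
    = real (Suc k) * ((LINT t:std_simplex k|PiM {..<k} (\<lambda>_. lborel). G t)
        / measure (PiM {..<k} (\<lambda>_. lborel)) (std_simplex k))"
proof -
  let ?L = "PiM {..<k} (\<lambda>_. lborel :: real measure)"
  let ?P = "PiM {..<Suc k} (\<lambda>_. expo)"
  let ?S = "\<lambda>e. \<Sum>i<Suc k. e i :: real"
  define C where "C = (\<integral>\<^sup>+s. ennreal (s * exp (- s)) * ennreal (s ^ k) \<partial>lborel)"
  have S_nonneg: "AE e in ?P. 0 \<le> ?S e"
  proof -
    have "AE e in ?P. \<forall>i\<in>{..<Suc k}. 0 \<le> e i"
      by (intro AE_finite_allI PiM_expo_component(3)) auto
    then show ?thesis
      by eventually_elim (rule sum_nonneg, blast)
  qed
  have S_int: "integrable ?P ?S"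
    by (intro Bochner_Integration.integrable_sum PiM_expo_component(1))
  have "(\<integral>\<^sup>+e. ennreal (?S e) \<partial>?P) = ennreal (\<integral>e. ?S e \<partial>?P)"
    by (intro nn_integral_eq_integral S_int S_nonneg)
  also have "(\<integral>e. ?S e \<partial>?P) = (\<Sum>i<Suc k. \<integral>e. e i \<partial>?P)"
    by (intro Bochner_Integration.integral_sum PiM_expo_component(1))
  also have "\<dots> = real (Suc k)"
    using PiM_expo_component(2)[of _ "{..<Suc k}"] by (simp del: sum.lessThan_Suc)
  finally have mass: "C * emeasure ?L (std_simplex k) = ennreal (real (Suc k))"
    using nn_integral_normalize_coords[of "\<lambda>_. 1" k] by (simp add: C_def)
  \<comment> \<open>In \<open>ennreal\<close>, infinity times a nonzero factor is infinite, so a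
    finite nonzero product makes both factors finite and yields the reals \<open>c\<close> and
    \<open>v\<close>.\<close>
  then have "C * emeasure ?L (std_simplex k) \<noteq> 0" "C * emeasure ?L (std_simplex k) < \<top>"
    by (auto simp: ennreal_eq_0_iff simp del: of_nat_Suc)
  then have "C < \<top>" "emeasure ?L (std_simplex k) < \<top>"
    by (auto simp: ennreal_mult_less_top)
  then obtain c v where c: "C = ennreal c" "0 \<le> c" and v: "emeasure ?L (std_simplex k) = ennreal v" "0 \<le> v"
    by (metis ennreal_cases less_irrefl infinity_ennreal_def)
  have cv: "c * v = real (Suc k)"
    using mass c v by (simp flip: ennreal_mult del: of_nat_Suc)
  \<comment> \<open>Equality of measures transports the Bochner integral of a signed
    \<open>G\<close>, which the formula for nonnegative functions alone does not cover.\<close>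
  have "distr (density ?P (\<lambda>e. ennreal (?S e))) ?L (normalize_coords k)
      = density ?L (\<lambda>t. ennreal (c * indicator (std_simplex k) t))"
  proof (rule measure_eqI)
    fix A assume "A \<in> sets (distr (density ?P (\<lambda>e. ennreal (?S e))) ?L (normalize_coords k))"
    then have [measurable]: "A \<in> sets ?L" by simp
    have "emeasure (distr (density ?P (\<lambda>e. ennreal (?S e))) ?L (normalize_coords k)) A
       = emeasure (density ?P (\<lambda>e. ennreal (?S e))) (normalize_coords k -` A \<inter> space ?P)"
      by (subst emeasure_distr) (auto simp del: sum.lessThan_Suc)
    also have "\<dots> = (\<integral>\<^sup>+e. ennreal (?S e) * indicator (normalize_coords k -` A \<inter> space ?P) e \<partial>?P)"
      by (rule emeasure_density) (auto simp del: sum.lessThan_Suc)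
    also have "\<dots> = (\<integral>\<^sup>+e. ennreal (?S e) * indicator A (normalize_coords k e) \<partial>?P)"
      by (intro nn_integral_cong) (auto simp: indicator_def)
    also have "\<dots> = C * (\<integral>\<^sup>+t. indicator (std_simplex k) t * indicator A t \<partial>?L)"
      unfolding C_def by (rule nn_integral_normalize_coords) measurable
    also have "\<dots> = (\<integral>\<^sup>+t. ennreal (c * indicator (std_simplex k) t) * indicator A t \<partial>?L)"
      using c by (subst nn_integral_cmult[symmetric]) (auto intro!: nn_integral_cong simp: indicator_def)
    also have "\<dots> = emeasure (density ?L (\<lambda>t. ennreal (c * indicator (std_simplex k) t))) A"
      by (rule emeasure_density[symmetric]) auto
    finally show "emeasure (distr (density ?P (\<lambda>e. ennreal (?S e))) ?L (normalize_coords k)) A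
       = emeasure (density ?L (\<lambda>t. ennreal (c * indicator (std_simplex k) t))) A" .
  qed simp
  then have "(\<integral>t. G t \<partial>distr (density ?P (\<lambda>e. ennreal (?S e))) ?L (normalize_coords k))
      = (\<integral>t. G t \<partial>density ?L (\<lambda>t. ennreal (c * indicator (std_simplex k) t)))" by simp
  moreover have "(\<integral>t. G t \<partial>distr (density ?P (\<lambda>e. ennreal (?S e))) ?L (normalize_coords k))
      = (\<integral>e. G (normalize_coords k e) \<partial>density ?P (\<lambda>e. ennreal (?S e)))"
    by (rule integral_distr) (auto simp del: sum.lessThan_Suc)
  moreover have "\<dots> = (\<integral>e. ?S e * G (normalize_coords k e) \<partial>?P)"
    using S_nonneg by (subst integral_density) (auto simp del: sum.lessThan_Suc)
  moreover have "(\<integral>t. G t \<partial>density ?L (\<lambda>t. ennreal (c * indicator (std_simplex k) t)))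
      = c * (LINT t:std_simplex k|?L. G t)"
    using c by (subst integral_density) (auto simp: set_lebesgue_integral_def mult.assoc)
  moreover have "measure ?L (std_simplex k) = v"
    using v by (simp add: measure_def)
  moreover have "v \<noteq> 0" using cv by auto
  ultimately show ?thesis
    using cv by (simp add: field_simps del: sum.lessThan_Suc of_nat_Suc)
qed

section \<open>Boundedness and measurability of convex functions on a simplex\<close>

text \<open>The maximum over \<open>V\<close> bounds \<open>f\<close> above. For the lower bound,
  \<open>q\<close> is reflected through the centroid \<open>c\<close> to a point \<open>r\<close>
  still in the hull; \<open>c\<close> lies between \<open>q\<close> and \<open>r\<close>, so
  convexity bounds \<open>f q\<close> below in terms of \<open>f c\<close> and the upper bound at
  \<open>r\<close>.\<close>

lemma convex_on_finite_hull_bounded: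
  assumes "convex_on (convex hull V) f" "finite V"
  obtains M where "\<And>y. y \<in> convex hull V \<Longrightarrow> \<bar>f y\<bar> \<le> M"
proof (cases "V = {}")
  case True
  then show ?thesis using that by simp
next
  case False
  define m where "m = real (card V)"
  have m: "m \<ge> 1" using False assms(2) by (simp add: m_def Suc_leI card_gt_0_iff)
  define c where "c = (\<Sum>v\<in>V. (1 / m) *\<^sub>R v)"
  have sum1: "(\<Sum>v\<in>V. 1 / m) = 1" using m by (simp add: m_def)
  have c: "c \<in> convex hull V"
    unfolding c_def using assms(2) m sum1
    by (intro convex_sum convex_convex_hull) (auto intro: hull_inc)
  define b where "b = Max (f ` V)"
  have ub: "f y \<le> b" if "y \<in> convex hull V" for y
    using convex_on_convex_hull_bound[OF assms(1), of b] that assms(2) by (auto simp: b_def)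
  have lb: "(m + 1) * f c - m * b \<le> f q" if q: "q \<in> convex hull V" for q
  proof -
    obtain u where u: "\<And>v. v \<in> V \<Longrightarrow> 0 \<le> u v" "sum u V = 1" "(\<Sum>v\<in>V. u v *\<^sub>R v) = q"
      using q convex_hull_finite[OF assms(2)] by auto
    have u1: "u v \<le> 1" if "v \<in> V" for v
      using member_le_sum[of v V u] u that assms(2) by auto
    \<comment> \<open>Weights of the reflected point \<open>r = c + (1 / m) (c - q)\<close>;
      shrinking the reflection by \<open>1 / m\<close> keeps them nonnegative, since
      \<open>u v\<close> is at most 1.\<close>
    define w where "w v = 1 / m + (1 / m) * (1 / m - u v)" for v
    have w0: "0 \<le> w v" if "v \<in> V" for v
    proof -
      have "0 \<le> (1 / m) * (1 + 1 / m - u v)"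
        using u1[OF that] m by (intro mult_nonneg_nonneg) (auto intro: add_increasing2)
      also have "\<dots> = w v" by (simp add: w_def algebra_simps)
      finally show ?thesis .
    qed
    have w1: "sum w V = 1"
      unfolding w_def sum.distrib sum_distrib_left[symmetric] sum_subtractf sum1 u by simp
    define r where "r = (\<Sum>v\<in>V. w v *\<^sub>R v)"
    have r: "r \<in> convex hull V"
      unfolding r_def using assms(2) w0 w1
      by (intro convex_sum convex_convex_hull) (auto intro: hull_inc)
    have r_eq: "r = c + (1 / m) *\<^sub>R (c - q)"
      unfolding r_def w_def c_def u(3)[symmetric]
      by (simp only: scaleR_add_left scaleR_diff_left sum.distrib sum_subtractf
          scaleR_scaleR[symmetric] scaleR_sum_right[symmetric])
    have q': "(m + 1) *\<^sub>R c = m *\<^sub>R r + q"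
      unfolding r_eq scaleR_add_right scaleR_scaleR using m by (simp add: scaleR_add_left)
    have "c = (1 / (m + 1)) *\<^sub>R ((m + 1) *\<^sub>R c)" using m by simp
    also have "\<dots> = (m / (m + 1)) *\<^sub>R r + (1 / (m + 1)) *\<^sub>R q"
      unfolding q' by (simp add: scaleR_add_right)
    finally have "f c = f ((m / (m + 1)) *\<^sub>R r + (1 / (m + 1)) *\<^sub>R q)" by simp
    also have "\<dots> \<le> (m / (m + 1)) * f r + (1 / (m + 1)) * f q"
      using assms(1)[unfolded convex_on_def, THEN conjunct2, rule_format, OF r q, of "m / (m + 1)" "1 / (m + 1)"] m
      by (simp add: add_divide_distrib[symmetric])
    also have "\<dots> = (m * f r + f q) / (m + 1)" by (simp add: add_divide_distrib)
    finally have "(m + 1) * f c \<le> m * f r + f q"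
      using m by (simp add: le_divide_eq mult.commute)
    also have "m * f r \<le> m * b" using ub[OF r] m by simp
    finally show ?thesis by simp
  qed
  show ?thesis
  proof (rule that)
    fix y assume "y \<in> convex hull V"
    then show "\<bar>f y\<bar> \<le> max \<bar>b\<bar> \<bar>(m + 1) * f c - m * b\<bar>"
      using lb[of y] ub[of y] by auto
  qed
qed

lemma simplex_param_alt:
  assumes "length ys = Suc k"
  shows "simplex_param ys t = (1 - (\<Sum>j<k. t j)) *\<^sub>R ys ! 0 + (\<Sum>j<k. t j *\<^sub>R ys ! Suc j)"
  using assms
  by (simp add: simplex_param_def scaleR_diff_right scaleR_diff_left sum_subtractf scaleR_sum_left)

lemma simplex_param_in_hull:
  assumes "length ys = Suc k" "\<forall>j<k. 0 \<le> t j" "(\<Sum>j<k. t j) \<le> 1"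
  shows "simplex_param ys t \<in> convex hull (set ys)"
proof -
  \<comment> \<open>Index \<open>k\<close> carries the base vertex \<open>ys ! 0\<close>, whose
    weight is the slack; all \<open>k + 1\<close> vertices then form one convex sum.\<close>
  let ?u = "\<lambda>i. if i < k then t i else 1 - (\<Sum>j<k. t j)"
  let ?y = "\<lambda>i. if i < k then ys ! Suc i else ys ! 0"
  have "(\<Sum>i<Suc k. ?u i *\<^sub>R ?y i) \<in> convex hull (set ys)"
    using assms by (intro convex_sum convex_convex_hull) (auto intro!: hull_inc)
  then show ?thesis
    using assms(1) by (simp add: simplex_param_alt add.commute)
qed

text \<open>A convex function on a simplex is upper semicontinuous in barycentric coordinates, because
  near \<open>p\<close> every point is \<open>(1 - \<epsilon>) p + \<epsilon> r\<close> with \<open>r\<close> in the simplex. This gives Borel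
  measurability including the boundary, which matters since the parameter measure is not complete.\<close>

lemma convex_on_simplex_param_measurable:
  fixes f :: "'a::real_vector \<Rightarrow> real"
  assumes len: "length ys = Suc k" and f: "convex_on (convex hull (set ys)) f"
  shows "(\<lambda>t. indicator (std_simplex k) t * f (simplex_param ys t)) \<in> borel_measurable (PiM {..<k} (\<lambda>_. lborel))"
proof -
  \<comment> \<open>\<open>T\<close> drops the extensionality in \<open>std_simplex k\<close>, so it
    lives in the full function space, where the product topology is available.\<close>
  define T where "T = {t :: nat \<Rightarrow> real. (\<forall>j\<in>{..<k}. 0 \<le> t j) \<and> (\<Sum>j<k. t j) \<le> 1}"
  define h where "h t = f (simplex_param ys t)" for t
  have cont: "continuous_on UNIV (\<lambda>t::nat \<Rightarrow> real. t j)" for j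
    by (rule continuous_on_product_coordinates)
  note [continuous_intros] = this continuous_on_sum
  have T_hull: "simplex_param ys t \<in> convex hull (set ys)" if "t \<in> T" for t
    using that simplex_param_in_hull[OF len] by (auto simp: T_def)
  obtain M where M: "\<And>y. y \<in> convex hull (set ys) \<Longrightarrow> \<bar>f y\<bar> \<le> M"
    using convex_on_finite_hull_bounded[OF f] by auto
  have usc: "\<exists>U. open U \<and> p \<in> U \<and> U \<inter> T \<subseteq> {t \<in> T. h t < c}" if p: "p \<in> T" "h p < c" for p c
  proof -
    have hp: "h p \<le> M" using M[OF T_hull[OF p(1)]] by (simp add: h_def abs_le_iff)
    \<comment> \<open>The fraction by which one may move from \<open>h p\<close> toward the bound
      \<open>M\<close> and stay below \<open>c\<close>. If \<open>M < c\<close>, halfway will do;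
      otherwise the increment is half the gap \<open>c - h p\<close>.\<close>
    define \<epsilon> where "\<epsilon> = (if M < c then 1 / 2 else (c - h p) / (2 * (M - h p)))"
    have \<epsilon>: "0 < \<epsilon>" "\<epsilon> < 1" "h p + \<epsilon> * (M - h p) < c"
    proof -
      have *: "M - h p > 0" if "\<not> M < c" using that p by simp
      show "0 < \<epsilon>" using * p(2) by (auto simp: \<epsilon>_def)
      show "\<epsilon> < 1" using * p(2) by (auto simp: \<epsilon>_def divide_less_eq)
      show "h p + \<epsilon> * (M - h p) < c"
      proof (cases "M < c")
        case True
        then show ?thesis using p(2) by (simp add: \<epsilon>_def field_simps)
      next
        case False
        then have "\<epsilon> * (M - h p) = (c - h p) / 2"
          using *[OF False] by (simp add: \<epsilon>_def divide_eq_eq)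
        then show ?thesis using p(2) by simp
      qed
    qed
    \<comment> \<open>Each positive barycentric coordinate of \<open>p\<close>, the slack included,
      may shrink in \<open>q\<close> by a factor greater than \<open>1 - \<epsilon>\<close> only.
      Zero coordinates of \<open>p\<close> impose nothing, as those of \<open>q\<close> in
      \<open>T\<close> are nonnegative.\<close>
    define U where "U = (\<Inter>j\<in>{j\<in>{..<k}. p j > 0}. {q. (1 - \<epsilon>) * p j < q j}) \<inter>
      (if (\<Sum>j<k. p j) < 1 then {q. (1 - \<epsilon>) * (1 - (\<Sum>j<k. p j)) < 1 - (\<Sum>j<k. q j)} else UNIV)"
    have "open U"
      unfolding U_def
      by (auto intro!: open_INT open_Int open_Collect_less continuous_intros)
    moreover have "p \<in> U"
      using \<epsilon> by (auto simp: U_def)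
    moreover have "h q < c" if q: "q \<in> U" "q \<in> T" for q
    proof -
      \<comment> \<open>The solution of \<open>q = (1 - \<epsilon>) p + \<epsilon> r\<close>; the
        conditions in \<open>U\<close> and \<open>T\<close> on \<open>q\<close> put \<open>r\<close>
        in \<open>T\<close>.\<close>
      define r where "r j = (q j - (1 - \<epsilon>) * p j) / \<epsilon>" for j
      have qr: "q j = (1 - \<epsilon>) * p j + \<epsilon> * r j" for j
        using \<epsilon> by (simp add: r_def)
      have "0 \<le> q j - (1 - \<epsilon>) * p j" if "j < k" for j
      proof (cases "p j > 0")
        case True
        then show ?thesis using q(1) that by (auto simp: U_def intro: less_imp_le)
      next
        case False
        then have "p j = 0" using p(1) that by (intro antisym) (auto simp: T_def)
        then show ?thesis using q(2) that by (simp add: T_def)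
      qed
      then have r0: "0 \<le> r j" if "j < k" for j
        using that \<epsilon> by (simp add: r_def)
      have sum_q: "(\<Sum>j<k. q j) = (1 - \<epsilon>) * (\<Sum>j<k. p j) + \<epsilon> * (\<Sum>j<k. r j)"
        by (simp add: qr sum.distrib sum_distrib_left)
      have "(1 - \<epsilon>) * (1 - (\<Sum>j<k. p j)) \<le> 1 - (\<Sum>j<k. q j)"
        using q p(1) by (cases "(\<Sum>j<k. p j) < 1") (auto simp: U_def T_def not_less)
      then have "\<epsilon> * (\<Sum>j<k. r j) \<le> \<epsilon> * 1"
        unfolding sum_q by (simp add: algebra_simps)
      then have r: "r \<in> T"
        using \<epsilon> r0 by (simp add: T_def)
      have "simplex_param ys q = (1 - \<epsilon>) *\<^sub>R simplex_param ys p + \<epsilon> *\<^sub>R simplex_param ys r"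
        unfolding simplex_param_alt[OF len] sum_q
        by (simp add: qr scaleR_add_right scaleR_add_left sum.distrib sum_subtractf scaleR_sum_right algebra_simps)
      then have "h q \<le> (1 - \<epsilon>) * h p + \<epsilon> * h r"
        using f T_hull[OF p(1)] T_hull[OF r] \<epsilon> unfolding h_def convex_on_def by auto
      also have "\<epsilon> * h r \<le> \<epsilon> * M"
        using M[OF T_hull[OF r]] \<epsilon> by (simp add: h_def abs_le_iff)
      finally show ?thesis
        using \<epsilon>(3) by (simp add: algebra_simps)
    qed
    ultimately show ?thesis by blast
  qed
  have "T = (\<Inter>j\<in>{..<k}. {t. 0 \<le> t j}) \<inter> {t. (\<Sum>j<k. t j) \<le> 1}"
    by (auto simp: T_def)
  also have "closed \<dots>"
    by (intro closed_INT closed_Int ballI closed_Collect_le continuous_intros)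
  finally have T: "T \<in> sets borel" by (rule borel_closed)
  have "h \<in> borel_measurable (restrict_space borel T)"
    unfolding borel_measurable_iff_less
  proof
    fix c
    \<comment> \<open>The largest open set whose trace on \<open>T\<close> lies in the strict
      sublevel set; by \<open>usc\<close> its trace is the whole sublevel set, which is thus
      relatively open.\<close>
    define W where "W = \<Union>{U. open U \<and> U \<inter> T \<subseteq> {t \<in> T. h t < c}}"
    have "open W" unfolding W_def by auto
    moreover have "{t \<in> T. h t < c} = T \<inter> W"
      using usc[of _ c] unfolding W_def by blast
    ultimately show "{w \<in> space (restrict_space borel T). h w < c} \<in> sets (restrict_space borel T)"
      by (auto simp: space_restrict_space sets_restrict_space)
  qed
  then have *[measurable]: "(\<lambda>t. indicator T t *\<^sub>R h t) \<in> borel_measurable borel"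
    using T by (subst (asm) borel_measurable_restrict_space_iff) auto
  \<comment> \<open>Extension by zero carries points of the product measure, which are
    \<open>undefined\<close> off \<open>{..<k}\<close>, to the full function space; membership in
    \<open>T\<close> and the value of \<open>h\<close> depend only on the first \<open>k\<close>
    coordinates.\<close>
  define \<iota> where "\<iota> t = (\<lambda>j. if j < k then t j else 0)" for t :: "nat \<Rightarrow> real"
  have "(\<lambda>t. if j < k then t j else 0) \<in> borel_measurable (PiM {..<k} (\<lambda>_. lborel :: real measure))" for j
    by (cases "j < k") simp_all
  then have [measurable]: "\<iota> \<in> borel_measurable (PiM {..<k} (\<lambda>_. lborel))"
    unfolding \<iota>_def by (rule measurable_coordinatewise_then_product)
  have "(\<lambda>t. indicator T (\<iota> t) *\<^sub>R h (\<iota> t)) \<in> borel_measurable (PiM {..<k} (\<lambda>_. lborel))"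
    by measurable
  also have "?this \<longleftrightarrow> ?thesis"
  proof (intro measurable_cong)
    fix t assume "t \<in> space (PiM {..<k} (\<lambda>_. lborel :: real measure))"
    then have "\<iota> t \<in> T \<longleftrightarrow> t \<in> std_simplex k"
      by (auto simp: \<iota>_def T_def std_simplex_def space_PiM)
    moreover have "h (\<iota> t) = f (simplex_param ys t)"
      using len by (simp add: h_def \<iota>_def simplex_param_def)
    ultimately show "indicator T (\<iota> t) *\<^sub>R h (\<iota> t) = indicator (std_simplex k) t * f (simplex_param ys t)"
      by (simp add: indicator_def)
  qed
  finally show ?thesis .
qed

section \<open>Face averages as expectations\<close>

text \<open>Off the hull \<open>f\<close> is arbitrary, so its perspective need not be measurable
  where some coordinate is negative; \<open>\<Psi>\<close> is a measurable version, built from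
  \<open>f\<close> cut off by the simplex indicator. The space over \<open>N\<close> serves all
  faces, so that their versions can be compared pointwise.\<close>

lemma face_avg_expectation:
  fixes x :: "nat \<Rightarrow> 'a::real_vector"
  assumes "finite N" "A \<subseteq> N" "A \<noteq> {}" and f: "convex_on (convex hull (x ` A)) f"
  obtains \<Psi> where "integrable (PiM N (\<lambda>_. expo)) \<Psi>"
    and "(\<integral>\<omega>. \<Psi> \<omega> \<partial>PiM N (\<lambda>_. expo)) = real (card A) * face_avg f x A"
    and "AE \<omega> in PiM N (\<lambda>_. expo). \<Psi> \<omega> = (\<Sum>i\<in>A. \<omega> i) * f ((\<Sum>i\<in>A. \<omega> i *\<^sub>R x i) /\<^sub>R (\<Sum>i\<in>A. \<omega> i))"
proof -
  let ?P = "PiM N (\<lambda>_. expo)"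
  have finA: "finite A" using assms finite_subset by blast
  define xs where "xs = sorted_list_of_set A"
  define k where "k = card A - 1"
  have Suc_k: "card A = Suc k" using assms finA by (simp add: k_def card_gt_0_iff)
  have xs: "set xs = A" "distinct xs" "length xs = Suc k"
    using finA Suc_k by (auto simp: xs_def)
  define ys where "ys = map x xs"
  have ys: "length ys = Suc k" "set ys = x ` A" using xs by (auto simp: ys_def)
  \<comment> \<open>\<open>simplex_param\<close> takes \<open>ys ! 0\<close> as base vertex, while
    \<open>normalize_coords\<close> drops coordinate \<open>k\<close>; hence the first vertex is
    enumerated last.\<close>
  define \<sigma> where "\<sigma> j = (if j = k then xs ! 0 else xs ! Suc j)" for j
  have inj: "inj_on \<sigma> {..<Suc k}"
    using xs(2,3) by (auto simp: inj_on_def \<sigma>_def nth_eq_iff_index_eq split: if_splits)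
  have "\<sigma> ` {..<Suc k} \<subseteq> A"
    using xs nth_mem[of _ xs] by (auto simp: \<sigma>_def)
  then have bij: "bij_betw \<sigma> {..<Suc k} A"
    using inj card_subset_eq[OF finA] by (simp add: bij_betw_def card_image Suc_k)
  then have \<sigma>A: "\<sigma> n \<in> A" if "n < Suc k" for n
    using that by (auto simp: bij_betw_def)
  define G where "G t = indicator (std_simplex k) t * f (simplex_param ys t)" for t
  have [measurable]: "G \<in> borel_measurable (PiM {..<k} (\<lambda>_. lborel))"
    unfolding G_def[abs_def] using ys f by (intro convex_on_simplex_param_measurable) auto
  define \<Phi> where "\<Phi> e = (\<Sum>i<Suc k. e i) * G (normalize_coords k e)" for e
  have \<Phi>[measurable]: "\<Phi> \<in> borel_measurable (PiM {..<Suc k} (\<lambda>_. expo))"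
    unfolding \<Phi>_def by measurable
  \<comment> \<open>Reads off the coordinates in \<open>A\<close> in the order of
    \<open>\<sigma>\<close>; as \<open>\<sigma>\<close> is injective, the image law is a product of
    \<open>k + 1\<close> exponentials.\<close>
  define \<iota> where "\<iota> \<omega> = (\<lambda>n\<in>{..<Suc k}. \<omega> (\<sigma> n))" for \<omega> :: "nat \<Rightarrow> real"
  have distr: "distr ?P (PiM {..<Suc k} (\<lambda>_. expo)) \<iota> = PiM {..<Suc k} (\<lambda>_. expo)"
    unfolding \<iota>_def using inj \<sigma>A assms(2)
    by (intro distr_PiM_reindex[where M="\<lambda>_. expo"] prob_space_expo) auto
  have \<iota>[measurable]: "\<iota> \<in> measurable ?P (PiM {..<Suc k} (\<lambda>_. expo))"
    unfolding \<iota>_def using \<sigma>A assms(2)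
    by (intro measurable_restrict measurable_component_singleton) auto
  have S_\<iota>: "(\<Sum>n<Suc k. \<iota> \<omega> n) = (\<Sum>i\<in>A. \<omega> i)" for \<omega>
    using sum.reindex_bij_betw[OF bij, of \<omega>] by (simp add: \<iota>_def)
  have nonneg: "AE \<omega> in ?P. \<forall>i\<in>N. 0 \<le> \<omega> i"
    using assms(1) by (intro AE_finite_allI PiM_expo_component(3)) auto
  have repr: "\<Phi> (\<iota> \<omega>) = (\<Sum>i\<in>A. \<omega> i) * f ((\<Sum>i\<in>A. \<omega> i *\<^sub>R x i) /\<^sub>R (\<Sum>i\<in>A. \<omega> i)) \<and>
      \<bar>\<Phi> (\<iota> \<omega>)\<bar> \<le> M * (\<Sum>i\<in>A. \<omega> i)"
    if \<omega>: "\<forall>i\<in>N. 0 \<le> \<omega> i" and M: "\<And>y. y \<in> convex hull (x ` A) \<Longrightarrow> \<bar>f y\<bar> \<le> M" for \<omega> M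
  proof (cases "(\<Sum>i\<in>A. \<omega> i) = 0")
    \<comment> \<open>A zero total annihilates both sides, whatever point \<open>f\<close> is
      evaluated at.\<close>
    case True
    then show ?thesis unfolding \<Phi>_def S_\<iota> by simp
  next
    case False
    define S where "S = (\<Sum>i\<in>A. \<omega> i)"
    have \<omega>A: "0 \<le> \<omega> i" if "i \<in> A" for i using that \<omega> assms(2) by auto
    have S: "S > 0" using False sum_nonneg[of A \<omega>] \<omega>A by (auto simp: S_def less_le)
    define t where "t = normalize_coords k (\<iota> \<omega>)"
    have t: "t j = \<omega> (\<sigma> j) / S" if "j < k" for j
      using that S_\<iota>[of \<omega>] by (simp add: t_def normalize_coords_def S_def \<iota>_def)
    have "(\<Sum>n<Suc k. \<omega> (\<sigma> n)) = S"
      using sum.reindex_bij_betw[OF bij, of \<omega>] by (simp add: S_def)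
    then have sum_t: "(\<Sum>j<k. t j) = 1 - \<omega> (\<sigma> k) / S"
      using S by (simp add: t sum_divide_distrib[symmetric] field_simps)
    have t_std: "t \<in> std_simplex k"
      using S \<omega>A \<sigma>A sum_t t by (auto simp: std_simplex_def t_def normalize_coords_def)
    have "simplex_param ys t = (\<omega> (\<sigma> k) / S) *\<^sub>R x (\<sigma> k) + (\<Sum>j<k. (\<omega> (\<sigma> j) / S) *\<^sub>R x (\<sigma> j))"
      using xs(3) unfolding simplex_param_alt[OF ys(1)] sum_t by (simp add: t ys_def \<sigma>_def)
    also have "\<dots> = (\<Sum>n<Suc k. (\<omega> (\<sigma> n) / S) *\<^sub>R x (\<sigma> n))"
      by simp
    also have "\<dots> = (\<Sum>i\<in>A. (\<omega> i / S) *\<^sub>R x i)"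
      by (rule sum.reindex_bij_betw[OF bij])
    also have "\<dots> = (\<Sum>i\<in>A. \<omega> i *\<^sub>R x i) /\<^sub>R S"
      by (simp add: scaleR_sum_right divide_inverse mult.commute)
    finally have bary: "simplex_param ys t = (\<Sum>i\<in>A. \<omega> i *\<^sub>R x i) /\<^sub>R S" .
    have "\<Phi> (\<iota> \<omega>) = S * f (simplex_param ys t)"
      unfolding \<Phi>_def S_\<iota> G_def t_def[symmetric] S_def[symmetric] using t_std by simp
    moreover have "\<bar>f (simplex_param ys t)\<bar> \<le> M"
      using M simplex_param_in_hull[OF ys(1), of t] t_std ys(2) by (auto simp: std_simplex_def)
    ultimately show ?thesis
      using S by (simp add: bary S_def[symmetric] abs_mult mult.commute)
  qed
  obtain M where M: "\<And>y. y \<in> convex hull (x ` A) \<Longrightarrow> \<bar>f y\<bar> \<le> M"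
    using convex_on_finite_hull_bounded[OF f] finA by blast
  show ?thesis
  proof (rule that[of "\<lambda>\<omega>. \<Phi> (\<iota> \<omega>)"])
    \<comment> \<open>The dominating function is the bound \<open>M\<close> times the total,
      integrable because exponentials have finite mean.\<close>
    have "integrable ?P (\<lambda>\<omega>. M * (\<Sum>i\<in>A. \<omega> i))"
      using assms(2)
      by (intro integrable_mult_right Bochner_Integration.integrable_sum PiM_expo_component(1)) auto
    then show "integrable ?P (\<lambda>\<omega>. \<Phi> (\<iota> \<omega>))"
    proof (rule Bochner_Integration.integrable_bound)
      show "AE \<omega> in ?P. norm (\<Phi> (\<iota> \<omega>)) \<le> norm (M * (\<Sum>i\<in>A. \<omega> i))"
        using nonneg by eventually_elim (use repr M in force)
    qed measurable
    have "(\<integral>\<omega>. \<Phi> (\<iota> \<omega>) \<partial>?P) = (\<integral>e. \<Phi> e \<partial>PiM {..<Suc k} (\<lambda>_. expo))"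
      using integral_distr[OF \<iota> \<Phi>] unfolding distr by simp
    also have "\<dots> = real (Suc k) * ((LINT t:std_simplex k|PiM {..<k} (\<lambda>_. lborel). G t)
        / measure (PiM {..<k} (\<lambda>_. lborel)) (std_simplex k))"
      unfolding \<Phi>_def by (rule integral_normalize_coords) measurable
    also have "(LINT t:std_simplex k|PiM {..<k} (\<lambda>_. lborel). G t)
        = (LINT t:std_simplex k|PiM {..<k} (\<lambda>_. lborel). f (simplex_param ys t))"
      unfolding set_lebesgue_integral_def G_def by (intro Bochner_Integration.integral_cong) (auto simp: indicator_def)
    finally show "(\<integral>\<omega>. \<Phi> (\<iota> \<omega>) \<partial>?P) = real (card A) * face_avg f x A"
      using ys(1) by (simp add: Suc_k face_avg_def simplex_avg_def param_measure_def xs_def[symmetric] ys_def[symmetric])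
    show "AE \<omega> in ?P. \<Phi> (\<iota> \<omega>) = (\<Sum>i\<in>A. \<omega> i) * f ((\<Sum>i\<in>A. \<omega> i *\<^sub>R x i) /\<^sub>R (\<Sum>i\<in>A. \<omega> i))"
      using nonneg by eventually_elim (use repr M in blast)
  qed
qed

section \<open>Subadditivity of the perspective and refinement of partitions\<close>

text \<open>The centroid of the union is the average of the centroids of the members, weighted by
  their masses \<open>S A\<close>. Jensen's inequality for these weights, multiplied by the total
  mass, gives the claim.\<close>

lemma perspective_subadditive:
  fixes x :: "nat \<Rightarrow> 'a::real_vector"
  assumes f: "convex_on C f" and xC: "\<And>i. i \<in> \<Union>Q \<Longrightarrow> x i \<in> C"
    and \<omega>: "\<And>i. i \<in> \<Union>Q \<Longrightarrow> 0 \<le> \<omega> i"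
    and Q: "finite Q" "pairwise disjnt Q" "finite (\<Union>Q)" "\<Union>Q \<noteq> {}"
  defines "\<phi> A \<equiv> (\<Sum>i\<in>A. \<omega> i) * f ((\<Sum>i\<in>A. \<omega> i *\<^sub>R x i) /\<^sub>R (\<Sum>i\<in>A. \<omega> i))"
  shows "\<phi> (\<Union>Q) \<le> (\<Sum>A\<in>Q. \<phi> A)"
proof -
  define S where "S A = (\<Sum>i\<in>A. \<omega> i)" for A
  have fin: "finite A" if "A \<in> Q" for A
    using that Q(3) by (meson Union_upper finite_subset)
  have S0: "0 \<le> S A" if "A \<in> Q" for A
    using that \<omega> by (auto simp: S_def intro!: sum_nonneg)
  have union: "sum g (\<Union>Q) = (\<Sum>A\<in>Q. sum g A)" for g :: "nat \<Rightarrow> 'b::comm_monoid_add"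
    using fin Q(2) by (subst sum.Union_disjoint) (auto simp: pairwise_def disjnt_def)
  have SU: "S (\<Union>Q) = (\<Sum>A\<in>Q. S A)"
    unfolding S_def by (rule union)
  show ?thesis
  proof (cases "S (\<Union>Q) = 0")
    case True
    then have "S A = 0" if "A \<in> Q" for A
      using that S0 Q(1) by (simp add: SU sum_nonneg_eq_0_iff)
    then have "(\<Sum>A\<in>Q. \<phi> A) = 0"
      by (intro sum.neutral) (auto simp: \<phi>_def S_def)
    with True show ?thesis by (simp add: \<phi>_def S_def)
  next
    case False
    then have pos: "S (\<Union>Q) > 0"
      using S0 sum_nonneg[of Q S] by (auto simp: SU less_le)
    obtain b where b: "b \<in> \<Union>Q" using Q(4) by blast
    \<comment> \<open>A member of mass zero has no centroid, and division by zero would give the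
      origin, possibly outside \<open>C\<close>. The vertex \<open>x b\<close> stands in, harmlessly
      because its Jensen weight is zero.\<close>
    define y where "y A = (if S A = 0 then x b else (\<Sum>i\<in>A. \<omega> i *\<^sub>R x i) /\<^sub>R S A)" for A
    have Sy: "S A *\<^sub>R y A = (\<Sum>i\<in>A. \<omega> i *\<^sub>R x i)" if A: "A \<in> Q" for A
    proof (cases "S A = 0")
      case True
      then have "\<omega> i = 0" if "i \<in> A" for i
        using sum_nonneg_0[OF fin[OF A], of \<omega> i] that \<omega> A unfolding S_def by blast
      with True show ?thesis by simp
    qed (simp add: y_def)
    have yC: "y A \<in> C" if A: "A \<in> Q" for A
    proof (cases "S A = 0")
      case False
      have "y A = (\<Sum>i\<in>A. (\<omega> i / S A) *\<^sub>R x i)"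
        using False by (simp add: y_def scaleR_sum_right divide_inverse mult.commute)
      also have "\<dots> \<in> C"
      proof (rule convex_sum[OF fin[OF A]])
        show "convex C" using f by (rule convex_on_imp_convex)
        show "(\<Sum>i\<in>A. \<omega> i / S A) = 1"
          using False by (simp add: sum_divide_distrib[symmetric] S_def[symmetric])
        show "0 \<le> \<omega> i / S A" "x i \<in> C" if "i \<in> A" for i
          using \<omega>[of i] xC[of i] S0[OF A] A that by (auto intro: divide_nonneg_nonneg)
      qed
      finally show ?thesis .
    qed (use xC b in \<open>simp add: y_def\<close>)
    have "(\<Sum>i\<in>\<Union>Q. \<omega> i *\<^sub>R x i) /\<^sub>R S (\<Union>Q) = (\<Sum>A\<in>Q. (S A / S (\<Union>Q)) *\<^sub>R y A)"
      by (simp add: union Sy[symmetric] scaleR_sum_right divide_inverse mult.commute)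
    also have "f \<dots> \<le> (\<Sum>A\<in>Q. (S A / S (\<Union>Q)) * f (y A))"
      using Q(4) pos S0 yC
      by (intro convex_on_sum[OF Q(1) _ f]) (auto simp: sum_divide_distrib[symmetric] SU[symmetric])
    finally have "\<phi> (\<Union>Q) \<le> S (\<Union>Q) * (\<Sum>A\<in>Q. (S A / S (\<Union>Q)) * f (y A))"
      using pos unfolding \<phi>_def S_def[symmetric] by (intro mult_left_mono) auto
    also have "\<dots> = (\<Sum>A\<in>Q. S A * f (y A))"
      using pos by (simp add: sum_distrib_left)
    also have "\<dots> = (\<Sum>A\<in>Q. \<phi> A)"
      by (intro sum.cong) (auto simp: y_def \<phi>_def S_def)
    finally show ?thesis .
  qed
qed

text \<open>Members of \<open>\<L>\<close> are nonempty, so disjointness makes the block of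
  \<open>\<K>\<close> containing a given one unique. Likewise a member of \<open>\<L>\<close> that
  meets a block \<open>B\<close> must lie in \<open>B\<close>, so these members cover
  \<open>B\<close>.\<close>

lemma sum_refines:
  fixes g :: "'b set \<Rightarrow> 'c::comm_monoid_add"
  assumes "finite N" "is_partition N \<K>" "is_partition N \<L>" "refines \<L> \<K>"
  shows "sum g \<L> = (\<Sum>B\<in>\<K>. \<Sum>A\<in>{A \<in> \<L>. A \<subseteq> B}. g A)"
    and "B \<in> \<K> \<Longrightarrow> \<Union>{A \<in> \<L>. A \<subseteq> B} = B"
proof -
  have K: "\<Union>\<K> = N" "pairwise disjnt \<K>" and L: "\<Union>\<L> = N" "\<forall>A\<in>\<L>. A \<noteq> {}"
    using assms(2,3) by (auto simp: is_partition_def)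
  have fin: "finite \<K>" "finite \<L>"
    using assms(1) K(1) L(1) by (auto intro: finite_UnionD)
  have disj: "B = B'" if "B \<in> \<K>" "B' \<in> \<K>" "i \<in> B" "i \<in> B'" for B B' i
    using K(2) that by (auto simp: pairwise_def disjnt_def)
  have "\<L> = (\<Union>B\<in>\<K>. {A \<in> \<L>. A \<subseteq> B})"
    using assms(4) by (auto simp: refines_def)
  then have "sum g \<L> = sum g (\<Union>B\<in>\<K>. {A \<in> \<L>. A \<subseteq> B})"
    by (rule arg_cong)
  also have "\<dots> = (\<Sum>B\<in>\<K>. \<Sum>A\<in>{A \<in> \<L>. A \<subseteq> B}. g A)"
  proof (intro sum.UNION_disjoint ballI impI)
    fix B B' assume B: "B \<in> \<K>" "B' \<in> \<K>" "B \<noteq> B'"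
    show "{A \<in> \<L>. A \<subseteq> B} \<inter> {A \<in> \<L>. A \<subseteq> B'} = {}"
    proof (rule equals0I)
      fix A assume A: "A \<in> {A \<in> \<L>. A \<subseteq> B} \<inter> {A \<in> \<L>. A \<subseteq> B'}"
      then obtain i where "i \<in> A" using L(2) by blast
      then show False using disj[of B B' i] A B by blast
    qed
  qed (use fin in auto)
  finally show "sum g \<L> = (\<Sum>B\<in>\<K>. \<Sum>A\<in>{A \<in> \<L>. A \<subseteq> B}. g A)" .
  show "\<Union>{A \<in> \<L>. A \<subseteq> B} = B" if B: "B \<in> \<K>"
  proof (intro equalityI subsetI)
    fix i assume i: "i \<in> B"
    then obtain A where A: "A \<in> \<L>" "i \<in> A" using B K(1) L(1) by blast
    then obtain B' where "B' \<in> \<K>" "A \<subseteq> B'" using assms(4) by (auto simp: refines_def)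
    then have "A \<subseteq> B" using disj[of B B' i] A B i by blast
    then show "i \<in> \<Union>{A \<in> \<L>. A \<subseteq> B}" using A by blast
  qed blast
qed

text \<open>Averages are taken in parameter space, so no measure on the target space enters; hence
  the form for a finite index set and a real vector space.\<close>

lemma F_part_refines_mono:
  fixes x :: "nat \<Rightarrow> 'a::real_vector"
  assumes N: "finite N" and f: "convex_on (convex hull (x ` N)) f"
    and parts: "is_partition N \<K>" "is_partition N \<L>" and ref: "refines \<L> \<K>"
  shows "F_part f x \<K> \<le> F_part f x \<L>"
proof -
  let ?P = "PiM N (\<lambda>_. expo)"
  define \<phi> where "\<phi> \<omega> A = (\<Sum>i\<in>A. \<omega> i) * f ((\<Sum>i\<in>A. \<omega> i *\<^sub>R x i) /\<^sub>R (\<Sum>i\<in>A. \<omega> i))" for \<omega> A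
  have sub: "A \<subseteq> N" "A \<noteq> {}" if "A \<in> \<K> \<union> \<L>" for A
    using that parts by (auto simp: is_partition_def)
  have fin: "finite \<K>" "finite \<L>"
    using N parts by (auto simp: is_partition_def intro: finite_UnionD)
  have "\<exists>\<Psi>. integrable ?P \<Psi> \<and> (\<integral>\<omega>. \<Psi> \<omega> \<partial>?P) = real (card A) * face_avg f x A
      \<and> (AE \<omega> in ?P. \<Psi> \<omega> = \<phi> \<omega> A)" if A: "A \<in> \<K> \<union> \<L>" for A
  proof -
    have "convex_on (convex hull (x ` A)) f"
      by (rule convex_on_subset[OF f hull_mono[OF image_mono[OF sub(1)[OF A]]] convex_convex_hull])
    from face_avg_expectation[OF N sub[OF A] this] obtain \<Psi> where
      "integrable ?P \<Psi>" "(\<integral>\<omega>. \<Psi> \<omega> \<partial>?P) = real (card A) * face_avg f x A" "AE \<omega> in ?P. \<Psi> \<omega> = \<phi> \<omega> A"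
      unfolding \<phi>_def by blast
    then show ?thesis by (intro exI[of _ \<Psi>] conjI)
  qed
  then have "\<forall>A\<in>\<K> \<union> \<L>. \<exists>\<Psi>. integrable ?P \<Psi> \<and> (\<integral>\<omega>. \<Psi> \<omega> \<partial>?P) = real (card A) * face_avg f x A
      \<and> (AE \<omega> in ?P. \<Psi> \<omega> = \<phi> \<omega> A)" by (rule ballI)
  \<comment> \<open>Fixes one version per face; there are finitely many, so off a single null set
    all of them agree with the perspectives.\<close>
  from bchoice[OF this] obtain \<Psi> where \<Psi>: "\<And>A. A \<in> \<K> \<union> \<L> \<Longrightarrow> integrable ?P (\<Psi> A)"
    "\<And>A. A \<in> \<K> \<union> \<L> \<Longrightarrow> (\<integral>\<omega>. \<Psi> A \<omega> \<partial>?P) = real (card A) * face_avg f x A"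
    "\<And>A. A \<in> \<K> \<union> \<L> \<Longrightarrow> AE \<omega> in ?P. \<Psi> A \<omega> = \<phi> \<omega> A"
    by blast
  have F: "F_part f x \<P> = (\<integral>\<omega>. (\<Sum>A\<in>\<P>. \<Psi> A \<omega>) \<partial>?P)" "integrable ?P (\<lambda>\<omega>. \<Sum>A\<in>\<P>. \<Psi> A \<omega>)"
    if "\<P> \<subseteq> \<K> \<union> \<L>" for \<P>
    using that \<Psi>(1,2) by (auto simp: F_part_def subset_iff)
  have "AE \<omega> in ?P. \<forall>i\<in>N. 0 \<le> \<omega> i"
    using N by (intro AE_finite_allI PiM_expo_component(3)) auto
  moreover have "AE \<omega> in ?P. \<forall>A\<in>\<K> \<union> \<L>. \<Psi> A \<omega> = \<phi> \<omega> A"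
    using fin \<Psi>(3) by (intro AE_finite_allI) auto
  ultimately have "AE \<omega> in ?P. (\<Sum>B\<in>\<K>. \<Psi> B \<omega>) \<le> (\<Sum>A\<in>\<L>. \<Psi> A \<omega>)"
  proof eventually_elim
    fix \<omega> assume \<omega>: "\<forall>i\<in>N. 0 \<le> \<omega> i" and eq: "\<forall>A\<in>\<K> \<union> \<L>. \<Psi> A \<omega> = \<phi> \<omega> A"
    have "(\<Sum>B\<in>\<K>. \<phi> \<omega> B) \<le> (\<Sum>B\<in>\<K>. \<Sum>A\<in>{A \<in> \<L>. A \<subseteq> B}. \<phi> \<omega> A)"
    proof (rule sum_mono)
      \<comment> \<open>The members of \<open>\<L>\<close> inside \<open>B\<close> form a partition
        of \<open>B\<close>, to which subadditivity applies.\<close>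
      fix B assume B: "B \<in> \<K>"
      let ?Q = "{A \<in> \<L>. A \<subseteq> B}"
      have U: "\<Union>?Q = B" by (rule sum_refines(2)[OF N parts ref B])
      have BN: "B \<subseteq> N" "B \<noteq> {}" using sub[of B] B by auto
      have "pairwise disjnt ?Q"
        using parts(2) by (auto simp: is_partition_def intro: pairwise_subset)
      then have "\<phi> \<omega> (\<Union>?Q) \<le> (\<Sum>A\<in>?Q. \<phi> \<omega> A)"
        unfolding \<phi>_def using BN \<omega> fin finite_subset[OF BN(1) N]
        by (intro perspective_subadditive[OF f]) (auto simp: U intro!: hull_inc)
      then show "\<phi> \<omega> B \<le> (\<Sum>A\<in>?Q. \<phi> \<omega> A)" unfolding U .
    qed
    also have "\<dots> = (\<Sum>A\<in>\<L>. \<phi> \<omega> A)"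
      by (rule sum_refines(1)[OF N parts ref, symmetric])
    finally show "(\<Sum>B\<in>\<K>. \<Psi> B \<omega>) \<le> (\<Sum>A\<in>\<L>. \<Psi> A \<omega>)"
      using eq by simp
  qed
  then show ?thesis
    using F[of \<K>] F[of \<L>] by (auto intro: integral_mono_AE)
qed

theorem theorem1:
  fixes x :: "nat \<Rightarrow> real ^ 'n" and f :: "real ^ 'n \<Rightarrow> real"
    and \<K> \<L> :: "nat set set"
  assumes "inj_on x {..CARD('n)}"
    and "\<not> affine_dependent (x ` {..CARD('n)})"
    and "convex_on (convex hull (x ` {..CARD('n)})) f"
    and "is_partition {..CARD('n)} \<K>"
    and "is_partition {..CARD('n)} \<L>"
    and "refines \<L> \<K>"
  shows "F_part f x \<K> \<le> F_part f x \<L>"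
  by (rule F_part_refines_mono[OF finite_atMost assms(3-6)])

end
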